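(* Let $\Psi:\mathbb{Q}[x]\to\mathbb{Q}$ be the linear form with $\Psi(x^n)=B_n$, where $\frac{t}{e^t-1}=\sum_{n\ge0}B_n\frac{t^n}{n!}$, and let $\mathscr{R}^-_n=\Psi\!\left(\binom{x+1}{2}^n\right)$ for $n\ge0$. Let $(R_n)_{n\ge0}$ be the Racah polynomials with parameters $(\alpha,\beta,\gamma,\delta)=(0,-1/2,0,0)$, and let $\Lambda$ be the unique linear form on $\mathbb{Q}[y]$ with $\Lambda(1)=1$ and $\Lambda(R_n)=0$ for all $n>0$. Then $\Lambda(y^n)=2^n\mathscr{R}^-_n$ for all $n\ge 0$, i.e. the numbers $(2^n\mathscr{R}^-_n)_{n\ge0}$ are the moments of this family of orthogonal polynomials.
   Context: For parameters $\alpha,\beta,\gamma,\delta$, the Racah polynomial $R_n$ is the polynomial of degree $n$ in a variable $y$ such that, with $\lambda(x)=x(x+\gamma+\delta+1)$, $$R_n(\lambda(x))=\sum_{k=0}^{n}\frac{(-n)_k(n+\alpha+\beta+1)_k(-x)_k(x+\gamma+\delta+1)_k}{(\alpha+1)_k(\beta+\delta+1)_k(\gamma+1)_k\,k!},$$ where $(a)_k=a(a+1)\cdots(a+k-1)$ is the Pochhammer symbol. The "moments" of the family are $\Lambda(y^n)$, $n\ge 0$. *)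

theory Defs
  imports "HOL-Computational_Algebra.Computational_Algebra"
begin

abbreviation linear_form :: "('a::field poly \<Rightarrow> 'a) \<Rightarrow> bool" where
  "linear_form \<equiv> Vector_Spaces.linear smult (*)"

lemma vector_space_poly: "vector_space (smult :: 'a::field \<Rightarrow> 'a poly \<Rightarrow> 'a poly)"
  by standard (simp_all add: smult_add_left smult_add_right)

lemma linear_form_iff:
  "linear_form L \<longleftrightarrow> (\<forall>p q. L (p + q) = L p + L q) \<and> (\<forall>c p. L (smult c p) = c * L p)"
proof -
  have "vector_space ((*) :: 'a \<Rightarrow> 'a \<Rightarrow> 'a)"
    by standard (simp_all add: algebra_simps)
  thus ?thesis
    by (auto simp: Vector_Spaces.linear_iff vector_space_poly)
qed

text \<open>The quotient of formal power series below is exact, although \<open>fps_exp 1 - 1\<close> is not a unit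
  (see \<open>bernoulli_gen_fun\<close>).\<close>

definition bernoulli :: "nat \<Rightarrow> rat" where
  "bernoulli n = fact n * fps_nth (fps_X / (fps_exp 1 - 1)) n"

lemma bernoulli_gen_fun:
  "Abs_fps (\<lambda>n. bernoulli n / fact n) * (fps_exp 1 - 1) = fps_X"
proof -
  have 1: "fps_nth (fps_exp (1::rat) - 1) 1 \<noteq> 0" by simp
  have ne: "fps_exp (1::rat) - 1 \<noteq> 0" using 1 by auto
  have "subdegree (fps_exp (1::rat) - 1) \<le> 1" using 1 by (rule subdegree_leI)
  hence "fps_exp (1::rat) - 1 dvd fps_X"
    using ne by (subst fps_dvd_iff) auto
  moreover have "Abs_fps (\<lambda>n. bernoulli n / fact n) = fps_X / (fps_exp 1 - 1)"
    by (simp add: fps_eq_iff bernoulli_def)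
  ultimately show ?thesis by simp
qed

definition binom_poly :: "rat poly" where
  "binom_poly = smult (1/2) ([:1, 1:] * [:0, 1:])"

lemma poly_binom_poly: "poly binom_poly x = (x + 1) gchoose 2"
  by (simp add: binom_poly_def gbinomial_prod_rev numeral_2_eq_2 algebra_simps)

definition racah_lambda :: "'a::field_char_0 \<Rightarrow> 'a \<Rightarrow> 'a \<Rightarrow> 'a" where
  "racah_lambda \<gamma> \<delta> x = x * (x + \<gamma> + \<delta> + 1)"

definition racah_sum :: "'a::field_char_0 \<Rightarrow> 'a \<Rightarrow> 'a \<Rightarrow> 'a \<Rightarrow> nat \<Rightarrow> 'a \<Rightarrow> 'a" where
  "racah_sum \<alpha> \<beta> \<gamma> \<delta> n x =
     (\<Sum>k=0..n. (pochhammer (- of_nat n) k * pochhammer (of_nat n + \<alpha> + \<beta> + 1) k *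
                 pochhammer (- x) k * pochhammer (x + \<gamma> + \<delta> + 1) k) /
                (pochhammer (\<alpha> + 1) k * pochhammer (\<beta> + \<delta> + 1) k * pochhammer (\<gamma> + 1) k * fact k))"

definition is_racah :: "'a::field_char_0 \<Rightarrow> 'a \<Rightarrow> 'a \<Rightarrow> 'a \<Rightarrow> nat \<Rightarrow> 'a poly \<Rightarrow> bool" where
  "is_racah \<alpha> \<beta> \<gamma> \<delta> n p \<longleftrightarrow>
     degree p = n \<and> (\<forall>x. poly p (racah_lambda \<gamma> \<delta> x) = racah_sum \<alpha> \<beta> \<gamma> \<delta> n x)"

text \<open>Meaningful only for parameters for which such a polynomial exists; sufficient conditions
  are given in \<open>is_racah_racah\<close>.\<close>

definition racah :: "'a::field_char_0 \<Rightarrow> 'a \<Rightarrow> 'a \<Rightarrow> 'a \<Rightarrow> nat \<Rightarrow> 'a poly" where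
  "racah \<alpha> \<beta> \<gamma> \<delta> n = (THE p. is_racah \<alpha> \<beta> \<gamma> \<delta> n p)"

lemma is_racah_unique:
  assumes "is_racah \<alpha> \<beta> \<gamma> \<delta> n p" "is_racah \<alpha> \<beta> \<gamma> \<delta> n q"
  shows "p = q"
proof -
  let ?l = "[:0, \<gamma> + \<delta> + 1, 1:]"
  have "poly ((p - q) \<circ>\<^sub>p ?l) x = 0" for x
  proof -
    have "poly ?l x = racah_lambda \<gamma> \<delta> x" by (simp add: racah_lambda_def algebra_simps)
    thus ?thesis using assms by (simp add: poly_pcompose is_racah_def)
  qed
  hence "(p - q) \<circ>\<^sub>p ?l = 0" by (simp add: poly_eq_poly_eq_iff[symmetric] fun_eq_iff)
  hence "p - q = 0" by (rule pcompose_eq_0) simp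
  thus ?thesis by simp
qed

lemma is_racah_racah:
  fixes \<alpha> \<beta> \<gamma> \<delta> :: "'a::field_char_0"
  assumes "pochhammer (of_nat n + \<alpha> + \<beta> + 1) n \<noteq> 0"
    and "pochhammer (\<alpha> + 1) n \<noteq> 0" "pochhammer (\<beta> + \<delta> + 1) n \<noteq> 0" "pochhammer (\<gamma> + 1) n \<noteq> 0"
  shows "is_racah \<alpha> \<beta> \<gamma> \<delta> n (racah \<alpha> \<beta> \<gamma> \<delta> n)"
proof -
  define c where "c k = pochhammer (- of_nat n) k * pochhammer (of_nat n + \<alpha> + \<beta> + 1) k /
    (pochhammer (\<alpha> + 1) k * pochhammer (\<beta> + \<delta> + 1) k * pochhammer (\<gamma> + 1) k * fact k)" for k
  define Q where "Q k = (\<Prod>j=0..<k. [:of_nat j * (of_nat j + \<gamma> + \<delta> + 1), -1:])" for k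
  define p where "p = (\<Sum>k=0..n. smult (c k) (Q k))"
  have Q: "poly (Q k) (racah_lambda \<gamma> \<delta> x) = pochhammer (- x) k * pochhammer (x + \<gamma> + \<delta> + 1) k" for k x
    unfolding Q_def pochhammer_prod poly_prod prod.distrib[symmetric]
    by (intro prod.cong) (simp_all add: racah_lambda_def algebra_simps)
  have degQ: "degree (Q k) = k" for k
    unfolding Q_def by (subst degree_prod_eq_sum_degree) auto
  have "pochhammer (- of_nat n :: 'a) n \<noteq> 0"
    by (simp add: pochhammer_same)
  hence cn: "c n \<noteq> 0" using assms by (simp add: c_def)
  have "degree p = n"
  proof (cases n)
    case 0
    thus ?thesis by (simp add: p_def Q_def)
  next
    case (Suc m)
    have "degree (\<Sum>k=0..m. smult (c k) (Q k)) \<le> m"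
      by (intro degree_sum_le) (auto intro: order.trans[OF degree_smult_le] simp: degQ)
    hence "degree (\<Sum>k=0..m. smult (c k) (Q k)) < degree (smult (c n) (Q n))"
      using cn Suc by (simp add: degQ)
    thus ?thesis using cn by (simp add: p_def Suc degree_add_eq_right degQ)
  qed
  moreover have "poly p (racah_lambda \<gamma> \<delta> x) = racah_sum \<alpha> \<beta> \<gamma> \<delta> n x" for x
    by (simp add: p_def poly_sum Q racah_sum_def c_def mult_ac)
  ultimately have "is_racah \<alpha> \<beta> \<gamma> \<delta> n p" by (simp add: is_racah_def)
  thus ?thesis unfolding racah_def by (rule theI) (rule is_racah_unique[OF _ \<open>is_racah \<alpha> \<beta> \<gamma> \<delta> n p\<close>])
qed

end

theory Submission
  imports Defs
begin

text \<open>Writing \<open>y = x(x + 1)\<close>, the form \<open>\<Lambda> p = \<Psi> (p(x(x + 1)))\<close> has the claimed moments, so it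
  remains to see that it kills \<open>R\<^sub>n\<close> for \<open>n > 0\<close>. The Bernoulli form satisfies
  \<open>\<Psi> (f(x + 1)) - \<Psi> f = f'(0)\<close>, which gives \<open>\<Psi> (binom x m) = (-1)\<^sup>m / (m + 1)\<close>; by Pascal's
  recurrence \<open>\<Psi> ((-x)\<^sub>k (x + 1)\<^sub>k) = k!\<^sup>2 / (2k + 1)\<close>. Hence \<open>\<Lambda> R\<^sub>n\<close> is the terminating series
  \<open>\<^sub>2F\<^sub>1(-n, n + 1/2; 3/2; 1)\<close>, which Chu-Vandermonde evaluates to
  \<open>(1 - n)\<^sub>n / (3/2)\<^sub>n = 0\<close>.\<close>

lemma linear_form_add: "linear_form L \<Longrightarrow> L (p + q) = L p + L q"
  by (simp add: linear_form_iff)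

lemma linear_form_smult: "linear_form L \<Longrightarrow> L (smult c p) = c * L p"
  by (simp add: linear_form_iff)

lemma linear_form_0: "linear_form L \<Longrightarrow> L 0 = 0"
  using linear_form_smult[of L 0 0] by simp

lemma linear_form_sum: "linear_form L \<Longrightarrow> L (sum f A) = (\<Sum>x\<in>A. L (f x))"
  by (induction A rule: infinite_finite_induct) (simp_all add: linear_form_0 linear_form_add)

lemma linear_form_pcompose:
  "linear_form L \<Longrightarrow> linear_form (\<lambda>p. L (p \<circ>\<^sub>p q))"
  by (simp add: linear_form_iff pcompose_add pcompose_smult)

text \<open>Polynomials with one member in each degree span the space: subtracting a multiple of
  \<open>p n\<close> cancels the leading term, and induction on the degree handles the rest.
  \<open>nz\<close> matters at n = 0, where \<open>deg\<close> alone would admit the zero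
  polynomial.\<close>

lemma linear_form_eqI:
  fixes L M :: "'a::field poly \<Rightarrow> 'a" and p :: "nat \<Rightarrow> 'a poly"
  assumes L: "linear_form L" and M: "linear_form M"
    and nz: "\<And>n. p n \<noteq> 0" and deg: "\<And>n. degree (p n) = n" and eq: "\<And>n. L (p n) = M (p n)"
  shows "L = M"
proof
  fix q show "L q = M q"
  proof (induction "degree q" arbitrary: q rule: less_induct)
    case less
    define n where "n = degree q"
    define c where "c = lead_coeff q / lead_coeff (p n)"
    define s where "s = q - smult c (p n)"
    have "lead_coeff (p n) \<noteq> 0" using nz by simp
    hence coeff_s: "coeff s n = 0" using deg by (simp add: s_def c_def n_def)
    have "degree s \<le> n"
      unfolding s_def by (rule degree_diff_le) (auto simp: n_def deg intro: order.trans[OF degree_smult_le])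
    hence "s = 0 \<or> degree s < n"
      using coeff_s by (metis leading_coeff_0_iff le_neq_implies_less)
    hence "L s = M s"
      using less[of s] L M by (auto simp: n_def linear_form_0)
    moreover have "q = s + smult c (p n)" by (simp add: s_def)
    ultimately show ?case
      using L M eq by (simp add: linear_form_add linear_form_smult)
  qed
qed

text \<open>Compare coefficients in \<open>bernoulli_gen_fun\<close> and multiply by n!. The term i
  = n drops out because \<open>fps_exp 1 - 1\<close> has no constant term.\<close>

lemma sum_binomial_bernoulli:
  "(\<Sum>i<n. of_nat (n choose i) * bernoulli i) = (if n = 1 then 1 else 0)"
proof -
  have "(\<Sum>i=0..n. bernoulli i / fact i * fps_nth (fps_exp 1 - 1) (n - i)) = fps_nth fps_X n"
    using arg_cong[OF bernoulli_gen_fun, of "\<lambda>f. fps_nth f n"] by (simp add: fps_mult_nth)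
  also have "(\<Sum>i=0..n. bernoulli i / fact i * fps_nth (fps_exp 1 - 1) (n - i)) =
      (\<Sum>i<n. bernoulli i / fact i * fps_nth (fps_exp 1 - 1) (n - i))"
    by (simp add: atLeast0AtMost lessThan_Suc_atMost[symmetric] mult.commute)
  also have "\<dots> = (\<Sum>i<n. of_nat (n choose i) * bernoulli i / fact n)"
    by (intro sum.cong) (auto simp: binomial_fact mult_ac)
  finally have "(\<Sum>i<n. of_nat (n choose i) * bernoulli i) = fact n * fps_nth fps_X n"
    by (simp add: sum_divide_distrib[symmetric] field_simps)
  thus ?thesis by auto
qed

text \<open>On a monomial the binomial theorem gives the sum in
  \<open>sum_binomial_bernoulli\<close> plus \<open>bernoulli n\<close>, so the difference is 1 for
  n = 1 and 0 otherwise. Linearity extends this to all p.\<close>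

lemma linear_form_shift:
  assumes \<Psi>: "linear_form \<Psi>" "\<And>n. \<Psi> (monom 1 n) = bernoulli n"
  shows "\<Psi> (p \<circ>\<^sub>p [:1, 1:]) - \<Psi> p = coeff p 1"
proof -
  have monom: "\<Psi> (monom 1 n \<circ>\<^sub>p [:1, 1:]) = \<Psi> (monom 1 n) + (if n = 1 then 1 else 0)" for n
  proof -
    have "monom (1 :: rat) n \<circ>\<^sub>p [:1, 1:] = (\<Sum>i\<le>n. smult (of_nat (n choose i)) (monom 1 i))"
    proof -
      have "monom 1 n \<circ>\<^sub>p [:1, 1:] = ([:1, 1:] :: rat poly) ^ n"
        by (simp add: poly_eq_poly_eq_iff[symmetric] fun_eq_iff poly_pcompose poly_monom)
      also have "\<dots> = (monom 1 1 + 1) ^ n" by (simp add: monom_Suc one_pCons)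
      also have "\<dots> = (\<Sum>i\<le>n. smult (of_nat (n choose i)) (monom 1 i))"
        unfolding binomial_ring by (simp add: monom_power of_nat_poly)
      finally show ?thesis .
    qed
    hence "\<Psi> (monom 1 n \<circ>\<^sub>p [:1, 1:]) = (\<Sum>i<n. of_nat (n choose i) * bernoulli i) + bernoulli n"
      using \<Psi>
      by (simp add: linear_form_sum linear_form_add linear_form_smult lessThan_Suc_atMost[symmetric])
    thus ?thesis
      using \<Psi>(2) by (simp only: sum_binomial_bernoulli add.commute)
  qed
  have p: "p = (\<Sum>i\<le>degree p. smult (coeff p i) (monom 1 i))"
    by (simp add: smult_monom poly_as_sum_of_monoms)
  have "\<Psi> (p \<circ>\<^sub>p [:1, 1:]) = (\<Sum>i\<le>degree p. coeff p i * \<Psi> (monom 1 i \<circ>\<^sub>p [:1, 1:]))"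
    using \<Psi>(1)
    by (subst p) (simp only: pcompose_sum pcompose_smult linear_form_sum linear_form_smult)
  moreover have "\<Psi> p = (\<Sum>i\<le>degree p. coeff p i * \<Psi> (monom 1 i))"
    using \<Psi>(1) by (subst p) (simp only: linear_form_sum linear_form_smult)
  ultimately have "\<Psi> (p \<circ>\<^sub>p [:1, 1:]) - \<Psi> p =
      (\<Sum>i\<le>degree p. coeff p i * (\<Psi> (monom 1 i \<circ>\<^sub>p [:1, 1:]) - \<Psi> (monom 1 i)))"
    by (simp only: sum_subtractf[symmetric] right_diff_distrib)
  also have "\<dots> = (\<Sum>i\<le>degree p. if i = 1 then coeff p i else 0)"
    by (intro sum.cong) (simp_all only: monom, simp_all)
  \<comment> \<open>For constant p the sum has no term i = 1, and \<open>coeff p 1\<close> is 0 as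
    well.\<close>
  also have "\<dots> = coeff p 1"
    by (simp add: coeff_eq_0 not_le)
  finally show ?thesis .
qed

text \<open>This is \<open>m! \<cdot> binom (x + j) m\<close> as a polynomial in \<open>x\<close>.\<close>

definition shifted_ffact :: "nat \<Rightarrow> nat \<Rightarrow> 'a::comm_ring_1 poly" where
  "shifted_ffact j m = (\<Prod>i<m. [:of_nat j - of_nat i, 1:])"

lemma shifted_ffact_Suc: "shifted_ffact j (Suc m) = [:of_nat j - of_nat m, 1:] * shifted_ffact j m"
  by (simp add: shifted_ffact_def mult.commute)

lemma shifted_ffact_Suc_Suc:
  "shifted_ffact (Suc j) (Suc m) = [:of_nat (Suc j), 1:] * shifted_ffact j m"
  by (simp add: shifted_ffact_def prod.lessThan_Suc_shift del: prod.lessThan_Suc)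

text \<open>Both products of length m + 1 contain \<open>shifted_ffact j m\<close>; the remaining
  factors x + j + 1 and x + j - m differ by the constant m + 1.\<close>

lemma shifted_ffact_pascal:
  "shifted_ffact (Suc j) (Suc m) = shifted_ffact j (Suc m) + smult (of_nat (Suc m)) (shifted_ffact j m)"
  unfolding shifted_ffact_Suc_Suc unfolding shifted_ffact_Suc
  by (simp add: algebra_simps smult_add_left[symmetric] smult_diff_left[symmetric])

lemma pcompose_shifted_ffact:
  "shifted_ffact j m \<circ>\<^sub>p [:1, 1:] = (shifted_ffact (Suc j) m :: 'a::comm_ring_1 poly)"
  unfolding shifted_ffact_def pcompose_prod by (intro prod.cong) (simp_all add: pcompose_pCons)

text \<open>The factor for i = 0 is x itself, so the linear coefficient is the product of the other
  factors at 0.\<close>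

lemma coeff_shifted_ffact_0:
  "coeff (shifted_ffact 0 (Suc m) :: 'a::{comm_ring_1,semiring_char_0} poly) 1 = (-1) ^ m * fact m"
proof -
  have "coeff (shifted_ffact 0 (Suc m) :: 'a poly) 1 = (\<Prod>i<m. - of_nat (Suc i))"
    by (simp add: shifted_ffact_def prod.lessThan_Suc_shift coeff_pCons poly_0_coeff_0[symmetric] poly_prod
        del: prod.lessThan_Suc)
  also have "\<dots> = (-1) ^ m * fact m"
    by (induction m) (simp_all add: algebra_simps)
  finally show ?thesis .
qed

text \<open>The 2k factors run from x - k + 1 to x + k: the upper half is (x + 1)_k, the lower half
  is (-x)_k up to sign. Each induction step adds one factor at either end.\<close>

lemma poly_shifted_ffact_central:
  fixes x :: "'a::comm_ring_1"
  shows "poly (shifted_ffact k (2 * k)) x = (-1) ^ k * (pochhammer (- x) k * pochhammer (x + 1) k)"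
proof (induction k)
  case 0
  show ?case by (simp add: shifted_ffact_def)
next
  case (Suc k)
  have "shifted_ffact (Suc k) (2 * Suc k) =
      [:of_nat (Suc k), 1:] * ([:of_nat k - of_nat (2 * k), 1:] * (shifted_ffact k (2 * k) :: 'a poly))"
    using shifted_ffact_Suc_Suc[of k "Suc (2 * k)", unfolded shifted_ffact_Suc[of k "2 * k"]] by simp
  hence "poly (shifted_ffact (Suc k) (2 * Suc k)) x =
      (x + of_nat (Suc k)) * ((x - of_nat k) * poly (shifted_ffact k (2 * k)) x)"
    by (simp only: poly_mult) (simp add: algebra_simps)
  thus ?case by (simp only: Suc) (simp add: pochhammer_Suc algebra_simps)
qed

text \<open>For j = 0 the shift rule is applied one degree higher, where Pascal's rule turns the
  difference into (m + 1) times the wanted value. Raising j by Pascal's rule uses the values at m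
  and m - 1, so m stays arbitrary in the induction.\<close>

lemma bernoulli_shifted_ffact:
  assumes \<Psi>: "linear_form \<Psi>" "\<And>n. \<Psi> (monom 1 n) = bernoulli n"
    and "j \<le> m"
  shows "\<Psi> (shifted_ffact j m) = (-1) ^ (m - j) * fact j * fact (m - j) / of_nat (Suc m)"
  using \<open>j \<le> m\<close>
proof (induction j arbitrary: m)
  case 0
  have "of_nat (Suc m) * \<Psi> (shifted_ffact 0 m) = (-1) ^ m * fact m"
    using linear_form_shift[OF \<Psi>, of "shifted_ffact 0 (Suc m)"] \<Psi>(1)
    by (simp only: pcompose_shifted_ffact shifted_ffact_pascal coeff_shifted_ffact_0
        linear_form_add linear_form_smult)
  thus ?case by (simp add: field_simps del: of_nat_Suc)
next
  case (Suc j)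
  then obtain d where m: "m = Suc (j + d)"
    by (metis Suc_le_D le_Suc_ex add_Suc)
  have "\<Psi> (shifted_ffact (Suc j) m) =
      \<Psi> (shifted_ffact j m) + of_nat m * \<Psi> (shifted_ffact j (j + d))"
    using \<Psi>(1) by (simp only: m shifted_ffact_pascal linear_form_add linear_form_smult)
  also have "\<dots> = (-1) ^ d * fact j * fact d * (1 - of_nat (Suc d) / of_nat (Suc m))"
    using Suc.IH[of m] Suc.IH[of "j + d"]
    by (simp add: m Suc_diff_le field_simps del: of_nat_Suc)
  also have "1 - of_nat (Suc d) / of_nat (Suc m) = (of_nat (Suc j) / of_nat (Suc m) :: rat)"
    by (simp add: m field_simps)
  finally show ?case by (simp add: m algebra_simps)
qed

text \<open>Both sides are twice (1/2)_(k+1). This absorbs the factor 1/(2k + 1) into the lower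
  parameter 3/2 of the hypergeometric series.\<close>

lemma pochhammer_half: "pochhammer (1/2 :: rat) k * of_nat (2 * k + 1) = pochhammer (3/2) k"
  by (induction k) (simp_all add: pochhammer_Suc field_simps)

text \<open>All Pochhammer symbols in the existence criterion have positive base here, so the
  description defining \<open>racah\<close> denotes.\<close>

lemma is_racah_half: "is_racah 0 (-1/2) 0 0 n (racah 0 (-1/2) 0 0 n :: rat poly)"
proof (rule is_racah_racah)
  have "pochhammer (of_nat n + 1/2 :: rat) n > 0" "pochhammer (1/2 :: rat) n > 0"
    by (intro pochhammer_pos; simp add: add_nonneg_pos)+
  thus "pochhammer (of_nat n + 0 + -1/2 + 1 :: rat) n \<noteq> 0" "pochhammer (-1/2 + 0 + 1 :: rat) n \<noteq> 0"
    by (simp_all add: add.commute)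
qed (simp_all add: pochhammer_fact[symmetric])

lemma bernoulli_racah:
  assumes \<Psi>: "linear_form \<Psi>" "\<And>n. \<Psi> (monom 1 n) = bernoulli n" and "n > 0"
  shows "\<Psi> (racah 0 (-1/2) 0 0 n \<circ>\<^sub>p [:0, 1, 1:]) = 0"
proof -
  \<comment> \<open>The cube collects k! and the two symbols (1)_k coming from \<alpha> = \<gamma> =
    0; the 1/2 is \<beta> + \<delta> + 1.\<close>
  define c :: "nat \<Rightarrow> rat" where "c k = pochhammer (- of_nat n) k * pochhammer (of_nat n + 1/2) k /
    (pochhammer (1/2) k * fact k ^ 3)" for k
  have "racah 0 (-1/2) 0 0 n \<circ>\<^sub>p [:0, 1, 1:] =
      (\<Sum>k=0..n. smult (c k * (-1) ^ k) (shifted_ffact k (2 * k)))" (is "?l = ?r")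
  proof -
    have "poly ?l x = poly ?r x" for x
    proof -
      have "poly ?l x = poly (racah 0 (-1/2) 0 0 n) (racah_lambda 0 0 x)"
        by (simp add: poly_pcompose racah_lambda_def algebra_simps)
      also have "\<dots> = racah_sum 0 (-1/2) 0 0 n x"
        using is_racah_half by (simp add: is_racah_def)
      also have "\<dots> = poly ?r x"
        unfolding racah_sum_def poly_sum
      proof (rule sum.cong)
        fix k
        have "pochhammer (- x) k * pochhammer (x + 1) k = (-1) ^ k * poly (shifted_ffact k (2 * k)) x"
          by (simp add: poly_shifted_ffact_central power_mult_distrib[symmetric])
        hence "c k * (pochhammer (- x) k * pochhammer (x + 1) k) =
            poly (smult (c k * (-1) ^ k) (shifted_ffact k (2 * k))) x"
          by simp
        thus "pochhammer (- of_nat n) k * pochhammer (of_nat n + 0 + - 1 / 2 + 1) k * pochhammer (- x) k *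
            pochhammer (x + 0 + 0 + 1) k / (pochhammer (0 + 1) k * pochhammer (- 1 / 2 + 0 + 1) k *
            pochhammer (0 + 1) k * fact k) = poly (smult (c k * (-1) ^ k) (shifted_ffact k (2 * k))) x"
          by (simp add: c_def pochhammer_fact[symmetric] power3_eq_cube add.commute mult_ac)
      qed simp
      finally show ?thesis .
    qed
    thus ?thesis by (simp add: poly_eq_poly_eq_iff[symmetric] fun_eq_iff)
  qed
  hence "\<Psi> ?l = (\<Sum>k=0..n. c k * (-1) ^ k * \<Psi> (shifted_ffact k (2 * k)))"
    using \<Psi>(1) by (simp add: linear_form_sum linear_form_smult)
  also have "\<dots> = (\<Sum>k=0..n. pochhammer (of_nat n + 1/2) k * pochhammer (- of_nat n) k /
      (of_nat (fact k) * pochhammer (3/2) k))"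
  proof (rule sum.cong)
    fix k
    have "\<Psi> (shifted_ffact k (2 * k)) = (-1) ^ k * fact k ^ 2 / of_nat (2 * k + 1)"
      using bernoulli_shifted_ffact[OF \<Psi>, of k "2 * k"] by (simp add: power2_eq_square)
    hence "c k * (-1) ^ k * \<Psi> (shifted_ffact k (2 * k)) = c k * fact k ^ 2 / of_nat (2 * k + 1)"
      by (simp add: power_mult_distrib[symmetric])
    thus "c k * (-1) ^ k * \<Psi> (shifted_ffact k (2 * k)) =
        pochhammer (of_nat n + 1/2) k * pochhammer (- of_nat n) k / (of_nat (fact k) * pochhammer (3/2) k)"
      unfolding pochhammer_half[symmetric]
      by (simp add: c_def power2_eq_square power3_eq_cube mult_ac)
  qed simp
  also have "\<dots> = pochhammer (3/2 - (of_nat n + 1/2)) n / pochhammer (3/2) n"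
  proof (rule Vandermonde_pochhammer, rule ballI)
    fix i
    have "(0 :: rat) \<le> of_nat i" by simp
    thus "(3/2 :: rat) \<noteq> - of_nat i" by linarith
  qed
  \<comment> \<open>The base is 1 - n, so the last factor, of index n - 1, vanishes; it exists
    because n > 0.\<close>
  also have "pochhammer (3/2 - (of_nat n + 1/2)) n = (0 :: rat)"
    unfolding pochhammer_eq_0_iff using \<open>n > 0\<close>
    by (intro exI[of _ "n - 1"]) (simp add: of_nat_diff)
  finally show ?thesis by simp
qed

theorem theorem2p1:
  fixes \<Psi> :: "rat poly \<Rightarrow> rat" and r :: "nat \<Rightarrow> rat"
  assumes "linear_form \<Psi>" and "\<And>n. \<Psi> (monom 1 n) = bernoulli n"
    and "\<And>n. r n = \<Psi> (binom_poly ^ n)"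
  shows "(\<exists>!\<Lambda> :: rat poly \<Rightarrow> rat. linear_form \<Lambda> \<and> \<Lambda> 1 = 1 \<and> (\<forall>n>0. \<Lambda> (racah 0 (-1/2) 0 0 n) = 0)) \<and>
    (\<forall>\<Lambda> :: rat poly \<Rightarrow> rat. linear_form \<Lambda> \<and> \<Lambda> 1 = 1 \<and> (\<forall>n>0. \<Lambda> (racah 0 (-1/2) 0 0 n) = 0) \<longrightarrow>
         (\<forall>n. \<Lambda> (monom 1 n) = 2 ^ n * r n))"
proof -
  define P :: "(rat poly \<Rightarrow> rat) \<Rightarrow> bool" where
    "P \<Lambda> \<longleftrightarrow> linear_form \<Lambda> \<and> \<Lambda> 1 = 1 \<and> (\<forall>n>0. \<Lambda> (racah 0 (-1/2) 0 0 n) = 0)" for \<Lambda>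
  define M where "M p = \<Psi> (p \<circ>\<^sub>p [:0, 1, 1:])" for p
  \<comment> \<open>With this, the normalisation at 1 supplies the degree 0 case when forms are
    compared on the Racah basis.\<close>
  have racah_0: "racah 0 (-1/2) 0 0 0 = (1 :: rat poly)"
    by (rule is_racah_unique[OF is_racah_half]) (simp add: is_racah_def racah_sum_def)
  have deg: "degree (racah 0 (-1/2) 0 0 n :: rat poly) = n" for n
    using is_racah_half by (simp add: is_racah_def)
  have nz: "racah 0 (-1/2) 0 0 n \<noteq> (0 :: rat poly)" for n
    using deg[of n] racah_0 by (cases n) auto
  have "bernoulli 0 = 1"
    using sum_binomial_bernoulli[of 1] by simp
  hence "M 1 = 1"
    using assms(2)[of 0] by (simp add: M_def pcompose_1)
  hence M: "P M"
    unfolding P_def using bernoulli_racah[OF assms(1,2)] linear_form_pcompose[OF assms(1)]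
    by (simp add: M_def[abs_def])
  have unique: "\<Lambda> = M" if "P \<Lambda>" for \<Lambda>
  proof (rule linear_form_eqI[where p = "racah 0 (-1/2) 0 0"])
    show "\<Lambda> (racah 0 (-1/2) 0 0 n) = M (racah 0 (-1/2) 0 0 n)" for n
      using that M racah_0 by (cases n) (auto simp: P_def)
  qed (use that M deg nz in \<open>auto simp: P_def\<close>)
  have "M (monom 1 n) = 2 ^ n * r n" for n
  proof -
    \<comment> \<open>The factor \<open>2 ^ n\<close> arises from x(x + 1) being twice
      \<open>binom_poly\<close>.\<close>
    have "monom 1 n \<circ>\<^sub>p [:0, 1, 1:] = smult (2 ^ n) (binom_poly ^ n)"
      by (simp add: poly_eq_poly_eq_iff[symmetric] fun_eq_iff poly_pcompose poly_monom
          binom_poly_def power_mult_distrib[symmetric] algebra_simps)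
    thus ?thesis using assms(1,3) by (simp add: M_def linear_form_smult)
  qed
  with M unique show ?thesis unfolding P_def[symmetric] by blast
qed

end
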